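(* Let $n_Q\ge1$ be an integer, $v$ a parameter, $g_Q$ a function as in the context, and $z_i,z_j,z_k$ nonzero parameters. For all decorated spins $\alpha,\beta,\gamma,\delta,\epsilon,\phi\in D$, with the weights $R$ of the context, $$\sum_{p,q,s\in D}R_{z_j,z_k}(\beta,\alpha;p,q)\,R_{z_i,z_k}(\gamma,p;\delta,s)\,R_{z_i,z_j}(s,q;\epsilon,\phi)=\sum_{p,q,s\in D}R_{z_i,z_j}(\gamma,\beta;p,q)\,R_{z_i,z_k}(q,\alpha;s,\phi)\,R_{z_j,z_k}(p,s;\delta,\epsilon).$$ (That is, the partition functions of the two three-strand systems with left boundary labels $\gamma,\beta,\alpha$ from top to bottom on the strands $z_i,z_j,z_k$ and right boundary labels $\delta,\epsilon,\phi$ from top to bottom, obtained by performing the crossings in the two possible orders, are equal.)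
   Context: Decorated spins: $D=\{-0,+1,+2,\dots,+n_Q\}$; decorations are integers mod $n_Q$ (so $+0$ means $+n_Q$), compared using representatives in $\{1,\dots,n_Q\}$. $g_Q:\mathbb Z\to\mathbb C$ is any function periodic mod $n_Q$ with $g_Q(0)=-v$ and $g_Q(t)g_Q(n_Q-t)=v$ for $t\not\equiv0\pmod{n_Q}$. $R$-vertex weights $R_{z_i,z_j}(p,s;t,u)$, with $p$ = top-left, $s$ = bottom-left, $t$ = top-right, $u$ = bottom-right edge (the $z_i$ strand runs from top-left to bottom-right, the $z_j$ strand from bottom-left to top-right). Put $x=(z_i/z_j)^{n_Q}$ (parameters are assumed such that all denominators $1-vx$ are nonzero); for $a,b\in\{1,\dots,n_Q\}$, $a\ne b$: $R(+a,+a;+a,+a)=\frac{-v+x}{1-vx}$; $R(+a,+b;+b,+a)=g_Q(a-b)\frac{1-x}{1-vx}$; $R(+a,+b;+a,+b)=\frac{1-v}{1-vx}\cdot x$ if $a>b$, and $\frac{1-v}{1-vx}$ if $a<b$; $R(-0,-0;-0,-0)=1$; $R(-0,+a;+a,-0)=\frac{v(1-x)}{1-vx}$; $R(+a,-0;-0,+a)=\frac{1-x}{1-vx}$; $R(+a,-0;+a,-0)=\frac{(1-v)x}{1-vx}$; $R(-0,+a;-0,+a)=\frac{1-v}{1-vx}$; all other values are $0$. For another pair of parameters, e.g. $R_{z_j,z_k}$, replace $x$ by $(z_j/z_k)^{n_Q}$, etc. *)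

theory Defs
  imports Complex_Main
begin

text \<open>
  A decoration, i.e. a residue modulo \<open>n\<close>, is encoded by its representative in \<open>{1..n}\<close>
  (so \<open>Plus n\<close> stands for both $+0$ and $+n$). The set \<open>decorated_spins n\<close> is $D$;
  terms \<open>Plus a\<close> with \<open>a\<close> outside \<open>{1..n}\<close> are junk values and do not belong to it.
\<close>

datatype spin = Minus0 | Plus nat

definition decorated_spins :: "nat \<Rightarrow> spin set" where
  "decorated_spins n = insert Minus0 (Plus ` {1..n})"

definition g_function :: "nat \<Rightarrow> complex \<Rightarrow> (int \<Rightarrow> complex) \<Rightarrow> bool" where
  "g_function n v g \<longleftrightarrow>
     (\<forall>t. g (t + int n) = g t) \<and>
     g 0 = - v \<and>
     (\<forall>t. \<not> int n dvd t \<longrightarrow> g t * g (int n - t) = v)"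

text \<open>
  \<open>R_entry v g x p s t u\<close> is the weight $R(p,s;t,u)$ with $p$ the top-left, $s$ the bottom-left,
  $t$ the top-right and $u$ the bottom-right edge.
\<close>

fun R_entry ::
  "complex \<Rightarrow> (int \<Rightarrow> complex) \<Rightarrow> complex \<Rightarrow> spin \<Rightarrow> spin \<Rightarrow> spin \<Rightarrow> spin \<Rightarrow> complex" where
  "R_entry v g x (Plus a) (Plus b) (Plus c) (Plus d) =
     (if a = b \<and> c = a \<and> d = a then (- v + x) / (1 - v * x)
      else if a \<noteq> b \<and> c = b \<and> d = a then g (int a - int b) * ((1 - x) / (1 - v * x))
      else if a > b \<and> c = a \<and> d = b then (1 - v) / (1 - v * x) * x
      else if a < b \<and> c = a \<and> d = b then (1 - v) / (1 - v * x)
      else 0)"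
| "R_entry v g x Minus0 Minus0 Minus0 Minus0 = 1"
| "R_entry v g x Minus0 (Plus a) (Plus b) Minus0 =
     (if a = b then v * (1 - x) / (1 - v * x) else 0)"
| "R_entry v g x (Plus a) Minus0 Minus0 (Plus b) =
     (if a = b then (1 - x) / (1 - v * x) else 0)"
| "R_entry v g x (Plus a) Minus0 (Plus b) Minus0 =
     (if a = b then (1 - v) * x / (1 - v * x) else 0)"
| "R_entry v g x Minus0 (Plus a) Minus0 (Plus b) =
     (if a = b then (1 - v) / (1 - v * x) else 0)"
| "R_entry v g x _ _ _ _ = 0"

definition R_weight ::
  "nat \<Rightarrow> complex \<Rightarrow> (int \<Rightarrow> complex) \<Rightarrow> complex \<Rightarrow> complex \<Rightarrow> spin \<Rightarrow> spin \<Rightarrow> spin \<Rightarrow> spin \<Rightarrow> complex" where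
  "R_weight n v g z w = R_entry v g ((z / w) ^ n)"

end

theory Submission
  imports Defs
begin

text \<open>
  Up to the scalar \<open>1 - v * x\<close>, every weight is a sum of two elementary ones: either the two
  labels stay on their strands (\<open>cross\<close>), or they are exchanged between the strands and so keep
  their heights (\<open>pass\<close>). A product of three weights with prescribed labels on the left is
  therefore a sum over eight choices, each of which sends the triple of left labels to one of its
  permutations on the right, and the sums over inner edges disappear. The Yang--Baxter equation
  becomes the statement that, for each permutation, both orders of the three crossings
  produce the same coefficient.

  These coefficients agree because of a Hecke algebra. Let \<open>T\<close> be the operator of the numerators
  at \<open>x = 0\<close>, and consider the labels as ordered with \<open>Minus0\<close> at the bottom. Two different labels
  \<open>a\<close>, \<open>b\<close> have exchange factors with product \<open>v\<close>: for decorations this is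
  $g_Q(a-b)\,g_Q(b-a) = v$, and for \<open>Minus0\<close> against a decoration it is $v \cdot 1$. This product is
  the only information on the factors that matters. It gives $(T-1)(T+v)=0$, and copies of \<open>T\<close> on
  adjacent strands satisfy the braid relation. The numerator at parameter \<open>x\<close> is
  $T + x(1-v-T)$, that is $T - x\,v\,T^{-1}$ for $v \ne 0$. This is the usual Baxterisation of a
  Hecke generator, for which the equation holds when the middle parameter is the product of the
  outer ones. Here that is $(z_i/z_k)^n = (z_i/z_j)^n (z_j/z_k)^n$.

  The two diagonal numerators \<open>1 - v * x\<close> (for \<open>Minus0\<close>) and \<open>x - v\<close> (for a decoration) correspond
  to the two eigenvalues \<open>1\<close> and \<open>-v\<close> of \<open>T\<close>. Any assignment of them to the labels works, so the
  equation is proved for an arbitrary finite ordered set of labels, each of one of two kinds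
  (\<open>graded_vertex.yang_baxter\<close>), with polynomial weights over a commutative ring. The
  coefficients are compared directly, according to which of the three labels coincide and how
  they are ordered (\<open>paths_balance\<close>).
\<close>

section \<open>A vertex model with graded labels\<close>

text \<open>
  The set \<open>bosonic\<close> singles out the labels with diagonal numerator \<open>1 - v * x\<close>. The map \<open>rank\<close>
  transports an order to the labels, whose type need not carry one.
\<close>

locale graded_vertex =
  fixes v :: "'b::comm_ring_1"
    and h :: "'a \<Rightarrow> 'a \<Rightarrow> 'b"
    and bosonic :: "'a set"
    and rank :: "'a \<Rightarrow> nat"
    and D :: "'a set"
  assumes finite_D: "finite D"
    and h_inverse: "\<And>a b. a \<in> D \<Longrightarrow> b \<in> D \<Longrightarrow> a \<noteq> b \<Longrightarrow> h a b * h b a = v"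
    and rank_inj: "inj_on rank D"
begin

definition cross :: "'b \<Rightarrow> 'a \<Rightarrow> 'a \<Rightarrow> 'b" where
  "cross x a b = (if a = b then if a \<in> bosonic then 1 - v * x else x - v else h a b * (1 - x))"

text \<open>
  For equal labels, staying on the strand and keeping the height are the same configuration. It
  is counted in \<open>cross\<close>, hence the value \<open>0\<close> here.
\<close>

definition pass :: "'b \<Rightarrow> 'a \<Rightarrow> 'a \<Rightarrow> 'b" where
  "pass x a b = (if a = b then 0 else if rank b < rank a then (1 - v) * x else 1 - v)"

definition weight :: "'b \<Rightarrow> 'a \<Rightarrow> 'a \<Rightarrow> 'a \<Rightarrow> 'a \<Rightarrow> 'b" where
  "weight x a b c d =
     cross x a b * of_bool (c = b \<and> d = a) + pass x a b * of_bool (c = a \<and> d = b)"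

lemma sum_weight_bottom:
  assumes "a \<in> D" "b \<in> D"
  shows "(\<Sum>d\<in>D. weight x a b c d * F d) =
    cross x a b * of_bool (c = b) * F a + pass x a b * of_bool (c = a) * F b"
proof -
  have "weight x a b c d * F d =
      (if d = a then cross x a b * of_bool (c = b) * F d else 0) +
      (if d = b then pass x a b * of_bool (c = a) * F d else 0)" for d
    by (auto simp: weight_def algebra_simps)
  then show ?thesis
    using assms finite_D by (simp add: sum.distrib)
qed

lemma sum_weight_top:
  assumes "a \<in> D" "b \<in> D"
  shows "(\<Sum>c\<in>D. weight x a b c d * F c) =
    cross x a b * of_bool (d = a) * F b + pass x a b * of_bool (d = b) * F a"
proof -
  have "weight x a b c d * F c =
      (if c = b then cross x a b * of_bool (d = a) * F c else 0) +
      (if c = a then pass x a b * of_bool (d = b) * F c else 0)" for c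
    by (auto simp: weight_def algebra_simps)
  then show ?thesis
    using assms finite_D by (simp add: sum.distrib)
qed

lemma sum_weight:
  assumes "a \<in> D" "b \<in> D"
  shows "(\<Sum>c\<in>D. \<Sum>d\<in>D. weight x a b c d * F c d) = cross x a b * F b a + pass x a b * F a b"
proof -
  have "(\<Sum>c\<in>D. \<Sum>d\<in>D. weight x a b c d * F c d) =
      (\<Sum>c\<in>D. (if c = b then cross x a b * F c a else 0) + (if c = a then pass x a b * F c b else 0))"
    unfolding sum_weight_bottom[OF assms] by (intro sum.cong) auto
  then show ?thesis
    using assms finite_D by (simp add: sum.distrib)
qed

section \<open>The Yang--Baxter equation\<close>

text \<open>
  The left labels are \<open>c\<close>, \<open>b\<close>, \<open>a\<close> from top to bottom, and \<open>f p q r\<close> stands for the permutation of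
  them found on the right. Since \<open>f\<close> is arbitrary, the equation says that the coefficients
  of each permutation agree. For distinct labels, three of the six coefficients have the same
  factors on both sides. For \<open>f c b a\<close> the two sides contain \<open>h b a * h a b\<close> and \<open>h c b * h b c\<close>,
  which are both \<open>v\<close>. For \<open>f c a b\<close> and \<open>f b c a\<close> two paths on one side balance a single path on
  the other, by an identity between polynomials in \<open>x\<close>, \<open>y\<close> and \<open>v\<close> that depends on the order of the
  labels. When exactly two labels coincide, several permutations become one and their coefficients
  add up. These contain a diagonal numerator, whose value at \<open>x = 0\<close> has to be one of the two
  roots of $(t-1)(t+v)$.
\<close>

lemma paths_balance:
  fixes f :: "'a \<Rightarrow> 'a \<Rightarrow> 'a \<Rightarrow> 'b"
  assumes D: "a \<in> D" "b \<in> D" "c \<in> D"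
  shows
   "cross y b a * (cross (x * y) c a * (cross x c b * f a b c + pass x c b * f a c b)
                 + pass (x * y) c a * (cross x a b * f c b a + pass x a b * f c a b))
  + pass y b a * (cross (x * y) c b * (cross x c a * f b a c + pass x c a * f b c a)
                 + pass (x * y) c b * (cross x b a * f c a b + pass x b a * f c b a))
  = cross x c b * (cross (x * y) c a * (cross y b a * f a b c + pass y b a * f b a c)
                 + pass (x * y) c a * (cross y b c * f c b a + pass y b c * f b c a))
  + pass x c b * (cross (x * y) b a * (cross y c a * f a c b + pass y c a * f c a b)
                 + pass (x * y) b a * (cross y c b * f b c a + pass y c b * f c b a))"
proof -
  have h_assoc: "p \<in> D \<Longrightarrow> q \<in> D \<Longrightarrow> p \<noteq> q \<Longrightarrow> h p q * (h q p * w) = v * w" for p q w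
    using h_inverse[of p q] by (simp add: mult.assoc[symmetric])
  have ranks: "p \<in> D \<Longrightarrow> q \<in> D \<Longrightarrow> p \<noteq> q \<Longrightarrow> rank p < rank q \<or> rank q < rank p" for p q
    using rank_inj by (metis inj_on_def linorder_neqE_nat)
  note expand = pass_def cross_def algebra_simps h_assoc h_inverse
  consider "a = b" "b = c" | "a = b" "b \<noteq> c" | "a = c" "b \<noteq> c" | "b = c" "a \<noteq> b"
    | "a \<noteq> b" "b \<noteq> c" "a \<noteq> c"
    by blast
  then show ?thesis
  proof cases
    case 1 then show ?thesis by (simp add: pass_def algebra_simps)
  next
    case 2 then show ?thesis using ranks[of a c] D by (auto simp: expand)
  next
    case 3 then show ?thesis using ranks[of b c] D by (auto simp: expand)
  next
    case 4 then show ?thesis using ranks[of b a] D by (auto simp: expand)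
  next
    case 5 then show ?thesis using ranks[of a b] ranks[of b c] ranks[of a c] D
      by (auto simp: expand)
  qed
qed

theorem yang_baxter:
  assumes D: "a \<in> D" "b \<in> D" "c \<in> D"
  shows "(\<Sum>p\<in>D. \<Sum>q\<in>D. \<Sum>s\<in>D.
        weight y b a p q * weight (x * y) c p d s * weight x s q e f)
   = (\<Sum>p\<in>D. \<Sum>q\<in>D. \<Sum>s\<in>D.
        weight x c b p q * weight (x * y) q a s f * weight y p s d e)"
proof -
  have l: "(\<Sum>p\<in>D. \<Sum>q\<in>D. \<Sum>s\<in>D. weight y b a p q * weight (x * y) c p d s * weight x s q e f)
    = (\<Sum>p\<in>D. \<Sum>q\<in>D. weight y b a p q *
         (cross (x * y) c p * of_bool (d = p) * weight x c q e f +
          pass (x * y) c p * of_bool (d = c) * weight x p q e f))"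
    by (intro sum.cong refl)
      (simp add: mult.assoc sum_distrib_left[symmetric] sum_weight_bottom D)
  have r: "(\<Sum>p\<in>D. \<Sum>q\<in>D. \<Sum>s\<in>D. weight x c b p q * weight (x * y) q a s f * weight y p s d e)
    = (\<Sum>p\<in>D. \<Sum>q\<in>D. weight x c b p q *
         (cross (x * y) q a * of_bool (f = q) * weight y p a d e +
          pass (x * y) q a * of_bool (f = a) * weight y p q d e))"
    by (intro sum.cong refl)
      (simp add: mult.assoc sum_distrib_left[symmetric] sum_weight_top D)
  show ?thesis
    unfolding l r sum_weight[OF D(2,1)] sum_weight[OF D(3,2)]
    using paths_balance[OF D, of y x "\<lambda>p q r. of_bool (d = p) * of_bool (e = q) * of_bool (f = r)"]
    by (simp add: weight_def algebra_simps of_bool_conj)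
qed

end

section \<open>Decorated spins as graded labels\<close>

fun exchange_factor :: "complex \<Rightarrow> (int \<Rightarrow> complex) \<Rightarrow> spin \<Rightarrow> spin \<Rightarrow> complex" where
  "exchange_factor v g (Plus a) (Plus b) = g (int a - int b)"
| "exchange_factor v g Minus0 (Plus b) = v"
| "exchange_factor v g _ Minus0 = 1"

fun spin_rank :: "spin \<Rightarrow> nat" where
  "spin_rank Minus0 = 0"
| "spin_rank (Plus a) = Suc a"

lemma exchange_factor_inverse:
  assumes g: "g_function n v g"
    and D: "p \<in> decorated_spins n" "q \<in> decorated_spins n" and "p \<noteq> q"
  shows "exchange_factor v g p q * exchange_factor v g q p = v"
proof (cases p; cases q)
  fix a b assume pq: "p = Plus a" "q = Plus b"
  with D \<open>p \<noteq> q\<close> have "a \<in> {1..n}" "b \<in> {1..n}" "a \<noteq> b"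
    by (auto simp: decorated_spins_def)
  then have "\<bar>int a - int b\<bar> < int n" "int a - int b \<noteq> 0"
    by auto
  then have "\<not> int n dvd int a - int b"
    using zdvd_not_zless[of "\<bar>int a - int b\<bar>" "int n"] by auto
  then have "g (int a - int b) * g (int n - (int a - int b)) = v"
    using g by (auto simp: g_function_def)
  moreover have "g (int n - (int a - int b)) = g (int b - int a)"
    using g unfolding g_function_def by (metis add.commute diff_diff_eq2 diff_add_eq)
  ultimately show ?thesis
    using pq by simp
qed (use \<open>p \<noteq> q\<close> in auto)

lemma graded_vertex_decorated_spins:
  assumes "g_function n v g"
  shows "graded_vertex v (exchange_factor v g) spin_rank (decorated_spins n)"
proof
  show "finite (decorated_spins n)"
    by (simp add: decorated_spins_def)
  show "inj_on spin_rank (decorated_spins n)"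
    by (rule inj_onI) (auto elim!: spin_rank.elims)
qed (rule exchange_factor_inverse[OF assms])

text \<open>
  The nonzero denominator is needed for the entry \<open>1\<close> at four edges \<open>Minus0\<close>, which becomes the
  quotient of \<open>1 - v * x\<close> by itself.
\<close>

lemma R_entry_eq_weight:
  assumes "g_function n v g" and "1 - v * x \<noteq> 0"
  shows "R_entry v g x p s t u =
    graded_vertex.weight v (exchange_factor v g) {Minus0} spin_rank x p s t u / (1 - v * x)"
proof -
  interpret graded_vertex v "exchange_factor v g" "{Minus0}" spin_rank "decorated_spins n"
    using assms(1) by (rule graded_vertex_decorated_spins)
  show ?thesis
    using assms(2)
    by (cases p; cases s; cases t; cases u) (auto simp: weight_def cross_def pass_def)
qed

theorem theorem5p7:
  fixes n :: nat and v :: complex and g :: "int \<Rightarrow> complex"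
    and z\<^sub>i z\<^sub>j z\<^sub>k :: complex
    and \<alpha> \<beta> \<gamma> \<delta> \<epsilon> \<phi> :: spin
  assumes "n \<ge> 1"
    and "g_function n v g"
    and "z\<^sub>i \<noteq> 0" and "z\<^sub>j \<noteq> 0" and "z\<^sub>k \<noteq> 0"
    and "1 - v * (z\<^sub>i / z\<^sub>j) ^ n \<noteq> 0"
    and "1 - v * (z\<^sub>i / z\<^sub>k) ^ n \<noteq> 0"
    and "1 - v * (z\<^sub>j / z\<^sub>k) ^ n \<noteq> 0"
    and "\<alpha> \<in> decorated_spins n" and "\<beta> \<in> decorated_spins n" and "\<gamma> \<in> decorated_spins n"
    and "\<delta> \<in> decorated_spins n" and "\<epsilon> \<in> decorated_spins n" and "\<phi> \<in> decorated_spins n"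
  shows
    "(\<Sum>p\<in>decorated_spins n. \<Sum>q\<in>decorated_spins n. \<Sum>s\<in>decorated_spins n.
        R_weight n v g z\<^sub>j z\<^sub>k \<beta> \<alpha> p q *
        R_weight n v g z\<^sub>i z\<^sub>k \<gamma> p \<delta> s *
        R_weight n v g z\<^sub>i z\<^sub>j s q \<epsilon> \<phi>)
   = (\<Sum>p\<in>decorated_spins n. \<Sum>q\<in>decorated_spins n. \<Sum>s\<in>decorated_spins n.
        R_weight n v g z\<^sub>i z\<^sub>j \<gamma> \<beta> p q *
        R_weight n v g z\<^sub>i z\<^sub>k q \<alpha> s \<phi> *
        R_weight n v g z\<^sub>j z\<^sub>k p s \<delta> \<epsilon>)"
proof -
  interpret graded_vertex v "exchange_factor v g" "{Minus0}" spin_rank "decorated_spins n"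
    using assms(2) by (rule graded_vertex_decorated_spins)
  define x y where "x = (z\<^sub>i / z\<^sub>j) ^ n" and "y = (z\<^sub>j / z\<^sub>k) ^ n"
  have xy: "(z\<^sub>i / z\<^sub>k) ^ n = x * y"
    using \<open>z\<^sub>j \<noteq> 0\<close> by (simp add: x_def y_def power_mult_distrib[symmetric])
  have R:
    "R_weight n v g z\<^sub>i z\<^sub>j p s t u = weight x p s t u / (1 - v * x)"
    "R_weight n v g z\<^sub>j z\<^sub>k p s t u = weight y p s t u / (1 - v * y)"
    "R_weight n v g z\<^sub>i z\<^sub>k p s t u = weight (x * y) p s t u / (1 - v * (x * y))" for p s t u
    using assms(6-8) R_entry_eq_weight[OF assms(2)]
    by (simp_all add: R_weight_def xy flip: x_def y_def)
  have common_denominator: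
    "A / (1 - v * y) * (B / (1 - v * (x * y))) * (C / (1 - v * x)) =
      A * B * C / ((1 - v * x) * (1 - v * (x * y)) * (1 - v * y))"
    "A / (1 - v * x) * (B / (1 - v * (x * y))) * (C / (1 - v * y)) =
      A * B * C / ((1 - v * x) * (1 - v * (x * y)) * (1 - v * y))" for A B C
    by (simp_all add: mult_ac)
  show ?thesis
    unfolding R common_denominator sum_divide_distrib[symmetric]
    using yang_baxter[OF assms(9-11)] by simp
qed

end
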